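(* For every real $t>0$, $$I_1(t)>\frac{(t/2)^3}{1-e^{-(t/2)^2}}.$$
   Context: $I_\nu$ denotes the modified Bessel function of the first kind, $$I_\nu(z)=\sum_{j=0}^\infty\frac{1}{j!\,\Gamma(\nu+j+1)}\left(\frac z2\right)^{2j+\nu}$$ for $\nu\in\mathbb{R}$ and $z\in\mathbb{C}$, where $\Gamma$ is the Euler gamma function; $I_1$ is the case $\nu=1$. *)

theory Defs
  imports "HOL-Analysis.Analysis"
begin

(* The power is the principal branch. HOL sets 0 powr 0 = 0, so the case of base and
   exponent 0, where the power in the series is 1, is treated separately (it matters for
   I_0(0) = 1). At the poles of Gamma, HOL has Gamma = 0 and division by 0 gives 0, which
   is the usual convention 1/Gamma = 0 there. *)
definition bessel_I :: "real \<Rightarrow> complex \<Rightarrow> complex" where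
  "bessel_I \<nu> z =
     (\<Sum>j. complex_of_real (1 / (fact j * Gamma (\<nu> + real j + 1))) *
          (if z = 0 \<and> 2 * real j + \<nu> = 0 then 1
           else (z / 2) powr complex_of_real (2 * real j + \<nu>)))"

end

theory Submission
  imports Defs
begin

text \<open>
  With $y = (t/2)^2$ the claim becomes $S(y) > y / (1 - e^{-y})$, where
  $S(y) = \sum_j y^j / (j!\,(j+1)!)$ and $I_1(t) = (t/2)\,S(y)$. The polynomial
  $P(y) = 1 + y/2 + y^2/12$ separates the two sides. It consists of the first three terms of $S$,
  whose other terms are positive. It is also the numerator of the $[2/2]$ Pade approximant
  $P(y)/P(-y)$ of $e^y$, which underestimates $e^y$ for $y \ge 0$; since $P(-y) = P(y) - y$, the
  inequality $P(y) \le e^y P(-y)$ rearranges to $y / (1 - e^{-y}) \le P(y)$.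
\<close>

text \<open>
  Write $Q(y) = P(-y)$. The quotient $e^{-y} P/Q$ equals 1 at 0 and decreases, because
  $P'Q - PQ' - PQ = -y^4/144$: all lower powers of $y$ cancel, which is what makes $P/Q$ a Pade
  approximant.
\<close>

lemma pade_2_2_le_exp:
  fixes y :: real
  assumes "y \<ge> 0"
  shows "(1 + y / 2 + y\<^sup>2 / 12) * exp (- y) \<le> 1 - y / 2 + y\<^sup>2 / 12"
proof -
  define P Q :: "real \<Rightarrow> real" where
    "P = (\<lambda>x. 1 + x / 2 + x\<^sup>2 / 12)" and "Q = (\<lambda>x. 1 - x / 2 + x\<^sup>2 / 12)"
  have Q_pos: "Q x > 0" for x
  proof -
    have "Q x = (x - 3)\<^sup>2 / 12 + 1 / 4"
      by (simp add: Q_def power2_eq_square field_simps)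
    then show ?thesis
      using zero_le_power2[of "x - 3"] by linarith
  qed
  have deriv: "((\<lambda>x. P x * exp (- x) / Q x) has_real_derivative
                  - (x ^ 4 / 144) * exp (- x) / (Q x)\<^sup>2) (at x)" for x
  proof -
    have dP: "(P has_real_derivative 1 / 2 + x / 6) (at x)"
      unfolding P_def by (auto intro!: derivative_eq_intros)
    have dQ: "(Q has_real_derivative - 1 / 2 + x / 6) (at x)"
      unfolding Q_def by (auto intro!: derivative_eq_intros)
    have "((\<lambda>x. P x * exp (- x) / Q x) has_real_derivative
            (((1 / 2 + x / 6) * exp (- x) - P x * exp (- x)) * Q x
              - P x * exp (- x) * (- 1 / 2 + x / 6)) / (Q x * Q x)) (at x)"
      using Q_pos[of x]
      by (auto intro!: derivative_eq_intros dP dQ)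
    moreover have "(1 / 2 + x / 6 - P x) * Q x - P x * (- 1 / 2 + x / 6) = - (x ^ 4 / 144)"
      by (simp add: P_def Q_def field_simps power2_eq_square power4_eq_xxxx)
    then have "((1 / 2 + x / 6) * exp (- x) - P x * exp (- x)) * Q x
              - P x * exp (- x) * (- 1 / 2 + x / 6) = - (x ^ 4 / 144) * exp (- x)"
      by algebra
    ultimately show ?thesis
      by (simp add: power2_eq_square)
  qed
  have "P y * exp (- y) / Q y \<le> P 0 * exp (- 0) / Q 0"
    by (rule DERIV_nonpos_imp_nonincreasing[OF assms]) (use deriv in \<open>force simp: divide_nonpos_nonneg\<close>)
  then have "P y * exp (- y) \<le> Q y"
    using Q_pos[of y] by (simp add: P_def Q_def divide_le_eq)
  then show ?thesis
    by (simp add: P_def Q_def)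
qed

lemma div_one_minus_exp_le:
  fixes y :: real
  assumes "y > 0"
  shows "y / (1 - exp (- y)) \<le> 1 + y / 2 + y\<^sup>2 / 12"
proof -
  have "y \<le> (1 + y / 2 + y\<^sup>2 / 12) * (1 - exp (- y))"
    using pade_2_2_le_exp[of y] assms by (simp add: algebra_simps diff_divide_distrib)
  then show ?thesis
    using assms by (simp add: divide_le_eq)
qed

lemma summable_bessel_I_1_series:
  fixes y :: real
  shows "summable (\<lambda>j. y ^ j / (fact j * fact (Suc j)))"
proof (rule summable_comparison_test')
  show "summable (\<lambda>j. \<bar>y\<bar> ^ j / fact j)"
    using summable_exp[of "\<bar>y\<bar>"] by (simp add: field_simps)
next
  fix j :: nat
  have "fact j * 1 \<le> fact j * (fact (Suc j) :: real)"
    by (intro mult_left_mono fact_ge_1) simp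
  then have "\<bar>y\<bar> ^ j / (fact j * fact (Suc j)) \<le> \<bar>y\<bar> ^ j / fact j"
    by (intro divide_left_mono) simp_all
  then show "norm (y ^ j / (fact j * fact (Suc j))) \<le> \<bar>y\<bar> ^ j / fact j"
    by (simp add: abs_mult power_abs)
qed

lemma bessel_I_1_series_gt:
  fixes y :: real
  assumes "y > 0"
  shows "1 + y / 2 + y\<^sup>2 / 12 < (\<Sum>j. y ^ j / (fact j * fact (Suc j)))"
proof -
  have "(\<Sum>j<3. y ^ j / (fact j * fact (Suc j))) < (\<Sum>j. y ^ j / (fact j * fact (Suc j)))"
    by (rule sum_less_suminf[OF summable_bessel_I_1_series]) (use assms in simp)
  then show ?thesis
    by (simp add: eval_nat_numeral)
qed

lemma bessel_I_1_of_real: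
  fixes t :: real
  assumes "t > 0"
  shows "bessel_I 1 (complex_of_real t) =
           complex_of_real (t / 2 * (\<Sum>j. ((t / 2)\<^sup>2) ^ j / (fact j * fact (Suc j))))"
proof -
  have summand: "complex_of_real (1 / (fact j * Gamma (1 + real j + 1))) *
          (if complex_of_real t = 0 \<and> 2 * real j + 1 = 0 then 1
           else (complex_of_real t / 2) powr complex_of_real (2 * real j + 1))
        = complex_of_real (t / 2 * (((t / 2)\<^sup>2) ^ j / (fact j * fact (Suc j))))" for j
  proof -
    have G: "Gamma (1 + real j + 1) = fact (Suc j)"
      using Gamma_fact[of "Suc j", where 'a = real] by (simp add: add_ac)
    have "(complex_of_real t / 2) powr complex_of_real (2 * real j + 1)
            = complex_of_real ((t / 2) powr real (Suc (2 * j)))"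
      using assms powr_of_real[of "t / 2" "2 * real j + 1"] by (simp add: add_ac)
    also have "(t / 2) powr real (Suc (2 * j)) = t / 2 * ((t / 2)\<^sup>2) ^ j"
      using assms by (subst powr_realpow) (simp_all add: power_mult)
    finally have power: "(complex_of_real t / 2) powr complex_of_real (2 * real j + 1)
            = complex_of_real (t / 2 * ((t / 2)\<^sup>2) ^ j)" .
    show ?thesis
      unfolding G power using assms by (simp del: fact_Suc)
  qed
  have "bessel_I 1 (complex_of_real t) =
          (\<Sum>j. complex_of_real (t / 2 * (((t / 2)\<^sup>2) ^ j / (fact j * fact (Suc j)))))"
    unfolding bessel_I_def summand ..
  also have "\<dots> = complex_of_real (\<Sum>j. t / 2 * (((t / 2)\<^sup>2) ^ j / (fact j * fact (Suc j))))"
    by (intro suminf_of_real[symmetric] summable_mult summable_bessel_I_1_series)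
  also have "(\<Sum>j. t / 2 * (((t / 2)\<^sup>2) ^ j / (fact j * fact (Suc j))))
               = t / 2 * (\<Sum>j. ((t / 2)\<^sup>2) ^ j / (fact j * fact (Suc j)))"
    by (intro suminf_mult summable_bessel_I_1_series)
  finally show ?thesis .
qed

theorem theorem1p3:
  fixes t :: real
  assumes "t > 0"
  shows "bessel_I 1 (complex_of_real t) \<in> \<real> \<and>
         Re (bessel_I 1 (complex_of_real t)) > (t / 2) ^ 3 / (1 - exp (- ((t / 2) ^ 2)))"
proof -
  define y where "y = (t / 2)\<^sup>2"
  have y: "y > 0"
    using assms by (simp add: y_def)
  have "y / (1 - exp (- y)) < (\<Sum>j. y ^ j / (fact j * fact (Suc j)))"
    using div_one_minus_exp_le[OF y] bessel_I_1_series_gt[OF y] by (rule le_less_trans)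
  then have "t / 2 * (y / (1 - exp (- y))) < t / 2 * (\<Sum>j. y ^ j / (fact j * fact (Suc j)))"
    using assms by (intro mult_strict_left_mono) simp_all
  moreover have "t / 2 * (y / (1 - exp (- y))) = (t / 2) ^ 3 / (1 - exp (- y))"
    by (simp add: y_def power3_eq_cube power2_eq_square)
  ultimately show ?thesis
    unfolding bessel_I_1_of_real[OF assms] y_def[symmetric]
    by (simp only: Re_complex_of_real Reals_of_real simp_thms)
qed

end
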